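(* Let $\alpha>0$, let $s>0$ be a step size, and let $f:\mathbb{R}^d\to\mathbb{R}$ be $\alpha$-strongly convex and differentiable, with minimizer $x^*$. Given deterministic $x_0,v_0\in\mathbb{R}^d$, let $(x_n,v_n)_{n\ge0}$ be generated by $$\begin{aligned} x_n' &= x_n + s v_n,\\ v_n' &= v_n - (1+s\sqrt{\alpha})^{-1}\left(s\sqrt{\alpha}\,v_n + s g_n\right) - s\sqrt{\alpha}\,v_n',\\ x_{n+1} &= x_n' - \delta_n,\\ v_{n+1} &= v_n' + (1+s\sqrt{\alpha})^{-1}\sqrt{\alpha}\,\delta_n, \end{aligned}$$ where at each iteration $n\ge 0$, $g_n$ is a random vector with $\mathbb{E}_n(g_n)=\nabla f(x_n')$, and $\delta_n$ is a random vector (chosen dependent on $g_n$) such that $$f(x_{n+1})\le f(x_n')-\frac{s^2}{2}\|g_n\|^2 .$$ Set $$L_n = f(x_n)-f(x^* )+\tfrac12\left\|\sqrt{\alpha}(x_n-x^* )+(1+s\sqrt{\alpha})v_n\right\|^2 .$$ Then for all $n\ge0$, $$\mathbb{E}_n(L_{n+1})\le(1+s\sqrt{\alpha})^{-1}L_n .$$ In particular, if $v_0=0$, then for all $n\ge0$, $$\mathbb{E}\left(f(x_n)-f(x^* )\right)\le 2(1+s\sqrt{\alpha})^{-n}\left(f(x_0)-f(x^* )\right).$$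
   Context: Here $\|\cdot\|$ and $\langle\cdot,\cdot\rangle$ are the Euclidean norm and inner product on $\mathbb{R}^d$. A convex function $f$ is $\alpha$-strongly convex if for all $x,y$ and every subgradient $g\in\partial f(y)$, $f(x)\ge f(y)+\langle g,x-y\rangle+\frac{\alpha}{2}\|x-y\|^2$. $\mathbb{E}_n$ denotes the expectation with respect to the randomness introduced in iteration $n$, i.e. the conditional expectation $\mathbb{E}(\cdot\mid\mathcal{F}_n)$, where $\mathcal{F}_n$ is the $\sigma$-algebra of the randomness introduced in iterations $0,\dots,n-1$ (so $\mathcal F_0$ is trivial, $x_n,v_n,x_n'$ are $\mathcal{F}_n$-measurable, and $g_n,\delta_n$ are $\mathcal{F}_{n+1}$-measurable, with $g_n$ integrable so that $\mathbb{E}_n(g_n)$ is defined). The decrease condition involves the norm of the actual random sample $g_n$, with no expectation, and holds almost surely; inequalities between random variables hold almost surely. The second line of the iteration is an implicit (linear) equation which uniquely determines $v_n'$, since $1+s\sqrt\alpha>0$. *)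

theory Defs
  imports "HOL-Probability.Probability"
begin

definition subdifferential :: "(real ^ 'd \<Rightarrow> real) \<Rightarrow> real ^ 'd \<Rightarrow> (real ^ 'd) set" where
  "subdifferential f y = {g. \<forall>x. f x \<ge> f y + g \<bullet> (x - y)}"

definition strongly_convex :: "real \<Rightarrow> (real ^ 'd \<Rightarrow> real) \<Rightarrow> bool" where
  "strongly_convex \<alpha> f \<longleftrightarrow>
     convex_on UNIV f \<and>
     (\<forall>x y. \<forall>g \<in> subdifferential f y.
        f x \<ge> f y + g \<bullet> (x - y) + \<alpha> / 2 * (norm (x - y))\<^sup>2)"

text \<open>The library's conditional expectation is only for real-valued functions; for a vector-valued
  integrable function it is taken componentwise. As for \<^const>\<open>real_cond_exp\<close>, this is one
  version, so equations involving it are to be stated almost everywhere.\<close>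

definition vec_cond_exp ::
  "'w measure \<Rightarrow> 'w measure \<Rightarrow> ('w \<Rightarrow> real ^ 'd) \<Rightarrow> 'w \<Rightarrow> real ^ 'd" where
  "vec_cond_exp M F X = (\<lambda>\<omega>. \<chi> i. real_cond_exp M F (\<lambda>\<omega>'. X \<omega>' $ i) \<omega>)"

definition lyapunov ::
  "(real ^ 'd \<Rightarrow> real) \<Rightarrow> real \<Rightarrow> real \<Rightarrow> real ^ 'd \<Rightarrow> real ^ 'd \<Rightarrow> real ^ 'd \<Rightarrow> real" where
  "lyapunov f \<alpha> s xstar x v =
     f x - f xstar + 1 / 2 * (norm (sqrt \<alpha> *\<^sub>R (x - xstar) + (1 + s * sqrt \<alpha>) *\<^sub>R v))\<^sup>2"

end

theory Submission
  imports Defs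
begin

text \<open>Write \<open>c = 1 + s * sqrt \<alpha>\<close> and \<open>z = sqrt \<alpha> (x - x*) + c v\<close>. The implicit update collapses to
  \<open>z\<^sub>n\<^sub>+\<^sub>1 = sqrt \<alpha> (x' - x*) + (v - s g) / c\<close>, in which \<open>\<delta>\<close> has disappeared. The decrease condition
  leaves a negative multiple of \<open>\<parallel>g\<parallel>\<^sup>2\<close>, and \<open>s\<^sup>2 \<parallel>g\<parallel>\<^sup>2 \<ge> 2 s \<langle>g, v\<rangle> - \<parallel>v\<parallel>\<^sup>2\<close> turns the
  bound on \<open>L\<^sub>n\<^sub>+\<^sub>1\<close> into one that is affine in \<open>g\<close>. So one may take conditional expectations
  without any second moment of \<open>g\<close>, and strong convexity at \<open>x'\<close>, tested against \<open>x\<close> and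
  \<open>x*\<close>, finishes the estimate.

  Smoothness of \<open>f\<close> is not assumed, so integrability comes from boundedness: as the initial data are
  deterministic, the decrease condition and quadratic growth of \<open>f\<close> around \<open>x*\<close> propagate almost sure
  bounds from \<open>(x\<^sub>n, v\<^sub>n)\<close> to \<open>g\<^sub>n\<close> and then to \<open>(x\<^sub>n\<^sub>+\<^sub>1, v\<^sub>n\<^sub>+\<^sub>1)\<close>.\<close>

subsection \<open>Strongly convex functions\<close>

text \<open>Strong convexity is phrased with subgradients, whereas the iteration supplies a
  gradient. Along the line through \<open>y\<close> and \<open>x\<close> the claim becomes the
  tangent inequality for the convex function \<open>\<phi>\<close> of one real variable, whose slope
  at 0 comes from the chain rule.\<close>

lemma convex_gradient_in_subdifferential:
  fixes f :: "real ^ 'd \<Rightarrow> real"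
  assumes "convex_on UNIV f" and grad: "GDERIV f y :> d"
  shows "d \<in> subdifferential f y"
  unfolding subdifferential_def
proof (intro CollectI allI)
  fix x
  define \<phi> where "\<phi> t = f (y + t *\<^sub>R (x - y))" for t :: real
  have "convex_on UNIV \<phi>"
  proof (rule convex_onI)
    fix t a b :: real
    assume "0 < t" "t < 1"
    have "y + ((1 - t) * a + t * b) *\<^sub>R (x - y)
        = (1 - t) *\<^sub>R (y + a *\<^sub>R (x - y)) + t *\<^sub>R (y + b *\<^sub>R (x - y))"
      by (simp add: algebra_simps)
    with convex_onD[OF assms(1), of t] \<open>0 < t\<close> \<open>t < 1\<close>
    show "\<phi> ((1 - t) *\<^sub>R a + t *\<^sub>R b) \<le> (1 - t) * \<phi> a + t * \<phi> b"
      by (simp add: \<phi>_def)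
  qed simp
  moreover have "(\<phi> has_field_derivative (x - y) \<bullet> d) (at 0)"
  proof -
    have "((\<lambda>t::real. y + t *\<^sub>R (x - y)) has_derivative (\<lambda>t. t *\<^sub>R (x - y))) (at 0)"
      by (auto intro!: derivative_eq_intros)
    moreover have "(f has_derivative (\<lambda>h. h \<bullet> d)) (at (y + 0 *\<^sub>R (x - y)))"
      using grad by (simp add: gderiv_def)
    ultimately have "(\<phi> has_derivative (\<lambda>t. (t *\<^sub>R (x - y)) \<bullet> d)) (at 0)"
      unfolding \<phi>_def by (rule has_derivative_compose)
    then show ?thesis
      by (rule has_derivative_imp_has_field_derivative) (simp add: mult.commute)
  qed
  ultimately have "\<phi> 1 - \<phi> 0 \<ge> ((x - y) \<bullet> d) * (1 - 0)"
    by (intro convex_on_imp_above_tangent[where A = UNIV]) auto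
  then show "f y + d \<bullet> (x - y) \<le> f x"
    by (simp add: \<phi>_def inner_commute)
qed

lemma strongly_convex_gradient:
  fixes f :: "real ^ 'd \<Rightarrow> real"
  assumes "strongly_convex \<alpha> f" "GDERIV f y :> d"
  shows "f y + d \<bullet> (x - y) + \<alpha> / 2 * (norm (x - y))\<^sup>2 \<le> f x"
  using assms convex_gradient_in_subdifferential[of f y d] unfolding strongly_convex_def by blast

text \<open>At a minimizer \<open>0\<close> is a subgradient, so the linear term vanishes. This
  converts bounds on the function gap into bounds on the distance to \<open>xstar\<close>, and later
  produces the factor 2 of the rate.\<close>

lemma strongly_convex_minimizer_growth:
  fixes f :: "real ^ 'd \<Rightarrow> real"
  assumes "strongly_convex \<alpha> f" "\<And>y. f xstar \<le> f y"
  shows "\<alpha> / 2 * (norm (x - xstar))\<^sup>2 \<le> f x - f xstar"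
proof -
  have "0 \<in> subdifferential f xstar"
    using assms(2) by (simp add: subdifferential_def)
  then show ?thesis
    using assms(1) by (fastforce simp: strongly_convex_def dest: spec[of _ x] spec[of _ xstar])
qed

subsection \<open>One step of the iteration\<close>

text \<open>Moving \<open>k *\<^sub>R v'\<close> to the left gives one factor \<open>1 + k\<close>.
  As \<open>1 - k / (1 + k) = 1 / (1 + k)\<close>, both \<open>v\<close> and
  \<open>s *\<^sub>R g\<close> carry \<open>inverse (1 + k)\<close> on the right; hence the
  square.\<close>

lemma momentum_step_explicit:
  fixes v v' g :: "'a::real_vector"
  assumes c: "1 + k > 0"
    and v': "v' = v - inverse (1 + k) *\<^sub>R (k *\<^sub>R v + s *\<^sub>R g) - k *\<^sub>R v'"
  shows "v' = (inverse (1 + k))\<^sup>2 *\<^sub>R (v - s *\<^sub>R g)"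
proof -
  define r where "r = inverse (1 + k)"
  have rc: "r * (1 + k) = 1"
    using c by (simp add: r_def)
  then have r1: "1 - r * k = r"
    by (simp add: algebra_simps)
  have "(1 + k) *\<^sub>R v' = v' + k *\<^sub>R v'"
    by (simp add: algebra_simps)
  also have "\<dots> = v - r *\<^sub>R (k *\<^sub>R v + s *\<^sub>R g)"
    using v' unfolding r_def by (metis add_diff_cancel diff_add_cancel)
  also have "\<dots> = (1 - r * k) *\<^sub>R v - (r * s) *\<^sub>R g"
    by (simp add: algebra_simps)
  finally have "(1 + k) *\<^sub>R v' = r *\<^sub>R (v - s *\<^sub>R g)"
    by (simp only: r1) (simp add: scaleR_diff_right)
  then have "r *\<^sub>R (1 + k) *\<^sub>R v' = r *\<^sub>R r *\<^sub>R (v - s *\<^sub>R g)"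
    by simp
  then show ?thesis
    using rc by (simp add: r_def power2_eq_square)
qed

text \<open>\<open>\<delta>\<close> enters through the position with coefficient \<open>-q\<close>
  and through the velocity with \<open>c * (r * q) = q\<close>, so it cancels.\<close>

lemma shifted_momentum_step:
  fixes x' xstar v g \<delta> :: "'a::real_vector"
  assumes "r * c = 1"
  shows "q *\<^sub>R (x' - \<delta> - xstar) + c *\<^sub>R (r\<^sup>2 *\<^sub>R (v - s *\<^sub>R g) + (r * q) *\<^sub>R \<delta>)
    = q *\<^sub>R (x' - xstar) + r *\<^sub>R (v - s *\<^sub>R g)"
proof -
  have eqs: "c * r\<^sup>2 = r" "c * (r * q) = q"
    using assms by (metis mult.assoc mult.commute mult_1 power2_eq_square)+
  show ?thesis
    by (simp only: scaleR_add_right scaleR_scaleR eqs) (simp add: scaleR_diff_right)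
qed

text \<open>The slack in the following inequality is
  \<open>(1 - r) r / 2 * \<parallel>s g - v\<parallel>\<^sup>2 + (1 - r) s\<^sup>2 / 2 * \<parallel>g\<parallel>\<^sup>2\<close>.\<close>

lemma quadratic_step_bound:
  fixes y v g :: "'a::real_inner"
  assumes "0 \<le> r" "r \<le> 1"
  shows "1 / 2 * (norm (q *\<^sub>R y + r *\<^sub>R (v - s *\<^sub>R g)))\<^sup>2 - s\<^sup>2 / 2 * (norm g)\<^sup>2
    \<le> 1 / 2 * (norm (q *\<^sub>R y + r *\<^sub>R v))\<^sup>2 + (1 - r) * r / 2 * (norm v)\<^sup>2
      - r * s * (g \<bullet> (q *\<^sub>R y + v))"
proof -
  have "0 \<le> (1 - r) * r / 2 * (norm (s *\<^sub>R g - v))\<^sup>2 + (1 - r) * s\<^sup>2 / 2 * (norm g)\<^sup>2"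
    using assms by simp
  also have "\<dots> = (1 / 2 * (norm (q *\<^sub>R y + r *\<^sub>R v))\<^sup>2 + (1 - r) * r / 2 * (norm v)\<^sup>2
      - r * s * (g \<bullet> (q *\<^sub>R y + v)))
      - (1 / 2 * (norm (q *\<^sub>R y + r *\<^sub>R (v - s *\<^sub>R g)))\<^sup>2 - s\<^sup>2 / 2 * (norm g)\<^sup>2)"
    unfolding power2_norm_eq_inner
    by (simp add: inner_add inner_diff inner_commute[of v g] inner_commute[of y g] inner_commute[of v y]
        power2_eq_square field_simps)
  finally show ?thesis
    by simp
qed

text \<open>In the application \<open>d\<close> is the gradient at \<open>x'\<close> and
  \<open>y\<close> is \<open>x' - xstar\<close>. After multiplication by
  \<open>c = 1 + s * q\<close> the gap \<open>fx' - fmin\<close> appears with weights 1 and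
  \<open>s * q\<close>: the first copy is estimated by \<open>fx\<close>, the second by
  \<open>fmin\<close>. With these weights all terms in \<open>d\<close> cancel, and only a
  nonpositive multiple of the squared norm of \<open>v\<close> is left over.\<close>

lemma quadratic_contraction:
  fixes y v d :: "'a::real_inner"
  assumes c: "c = 1 + s * q" and rc: "r * c = 1"
    and fx: "fx' \<le> fx + s * (d \<bullet> v) - q\<^sup>2 / 2 * (s\<^sup>2 * (norm v)\<^sup>2)"
    and fmin: "fx' - fmin \<le> d \<bullet> y - q\<^sup>2 / 2 * (norm y)\<^sup>2"
    and "0 \<le> s" "0 \<le> q"
  shows "fx' - fmin + 1 / 2 * (norm (q *\<^sub>R y + r *\<^sub>R v))\<^sup>2 + (1 - r) * r / 2 * (norm v)\<^sup>2
      - r * s * (d \<bullet> (q *\<^sub>R y + v))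
    \<le> r * (fx - fmin + 1 / 2 * (norm (q *\<^sub>R y + v))\<^sup>2)" (is "?A \<le> r * ?B")
proof -
  have c0: "0 < c"
    using assms by (simp add: add_pos_nonneg)
  have r: "r = 1 / c"
    using rc c0 by (simp add: field_simps)
  have "c * ?A = (fx' - fmin) + s * q * (fx' - fmin) - s * (d \<bullet> v) - s * q * (d \<bullet> y)
      + 1 / 2 * ((q\<^sup>2 + s * q * q\<^sup>2) * (norm y)\<^sup>2 + 2 * q * (y \<bullet> v) + (norm v)\<^sup>2)"
  proof -
    have "c * ?A = c * (fx' - fmin) + c / 2 * (norm (q *\<^sub>R y + r *\<^sub>R v))\<^sup>2
        + (1 - r) * (r * c) / 2 * (norm v)\<^sup>2 - (r * c) * s * (d \<bullet> (q *\<^sub>R y + v))"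
      by (simp add: algebra_simps)
    also have "c / 2 * (norm (q *\<^sub>R y + r *\<^sub>R v))\<^sup>2
        = 1 / 2 * (c * q\<^sup>2 * (norm y)\<^sup>2 + 2 * (r * c) * q * (y \<bullet> v) + (r * c) * r * (norm v)\<^sup>2)"
      unfolding power2_norm_eq_inner
      by (simp add: inner_add inner_commute[of v y] power2_eq_square algebra_simps)
    finally show ?thesis
      unfolding rc by (simp add: c inner_add field_simps)
  qed
  also have "\<dots> \<le> (fx + s * (d \<bullet> v) - q\<^sup>2 / 2 * (s\<^sup>2 * (norm v)\<^sup>2) - fmin)
      + s * q * (d \<bullet> y - q\<^sup>2 / 2 * (norm y)\<^sup>2) - s * (d \<bullet> v) - s * q * (d \<bullet> y)
      + 1 / 2 * ((q\<^sup>2 + s * q * q\<^sup>2) * (norm y)\<^sup>2 + 2 * q * (y \<bullet> v) + (norm v)\<^sup>2)"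
    using fx mult_left_mono[OF fmin, of "s * q"] assms(5,6) by simp
  also have "\<dots> = ?B - q\<^sup>2 / 2 * (s\<^sup>2 * (norm v)\<^sup>2)"
    unfolding power2_norm_eq_inner
    by (simp add: inner_add inner_commute[of v y] power2_eq_square algebra_simps)
  also have "\<dots> \<le> ?B"
    by simp
  finally show ?thesis
    using c0 by (simp add: r field_simps)
qed

subsection \<open>Almost surely bounded random variables\<close>

definition ae_bounded :: "'w measure \<Rightarrow> ('w \<Rightarrow> 'a::real_normed_vector) \<Rightarrow> bool" where
  "ae_bounded M X \<longleftrightarrow> (\<exists>K. AE \<omega> in M. norm (X \<omega>) \<le> K)"

lemma ae_boundedI: "(AE \<omega> in M. norm (X \<omega>) \<le> K) \<Longrightarrow> ae_bounded M X"
  by (auto simp: ae_bounded_def)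

lemma ae_bounded_const: "ae_bounded M (\<lambda>\<omega>. a)"
  by (rule ae_boundedI[where K = "norm a"]) simp

lemma ae_bounded_add:
  assumes "ae_bounded M X" "ae_bounded M Y"
  shows "ae_bounded M (\<lambda>\<omega>. X \<omega> + Y \<omega>)"
proof -
  obtain K L where "AE \<omega> in M. norm (X \<omega>) \<le> K" "AE \<omega> in M. norm (Y \<omega>) \<le> L"
    using assms by (auto simp: ae_bounded_def)
  then have "AE \<omega> in M. norm (X \<omega> + Y \<omega>) \<le> K + L"
    by eventually_elim (rule norm_triangle_mono)
  then show ?thesis by (rule ae_boundedI)
qed

lemma ae_bounded_scaleR:
  assumes "ae_bounded M X"
  shows "ae_bounded M (\<lambda>\<omega>. a *\<^sub>R X \<omega>)"
proof -
  obtain K where "AE \<omega> in M. norm (X \<omega>) \<le> K"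
    using assms by (auto simp: ae_bounded_def)
  then have "AE \<omega> in M. norm (a *\<^sub>R X \<omega>) \<le> \<bar>a\<bar> * K"
    by eventually_elim (simp add: mult_left_mono)
  then show ?thesis by (rule ae_boundedI)
qed

lemma ae_bounded_diff:
  assumes "ae_bounded M X" "ae_bounded M Y"
  shows "ae_bounded M (\<lambda>\<omega>. X \<omega> - Y \<omega>)"
  using ae_bounded_add[OF assms(1) ae_bounded_scaleR[OF assms(2), of "-1"]] by simp

text \<open>Closed balls are compact in a Euclidean space, so continuity alone bounds
  \<open>h\<close> along a bounded random variable.\<close>

lemma ae_bounded_continuous_image:
  fixes h :: "'a::euclidean_space \<Rightarrow> 'b::real_normed_vector"
  assumes "continuous_on UNIV h" "ae_bounded M X"
  shows "ae_bounded M (\<lambda>\<omega>. h (X \<omega>))"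
proof -
  obtain K where K: "AE \<omega> in M. norm (X \<omega>) \<le> K"
    using assms(2) by (auto simp: ae_bounded_def)
  have "compact (h ` cball 0 K)"
    using assms(1) by (intro compact_continuous_image compact_cball) (rule continuous_on_subset, auto)
  then obtain B where B: "\<And>a. a \<in> cball 0 K \<Longrightarrow> norm (h a) \<le> B"
    using compact_imp_bounded by (fastforce simp: bounded_iff)
  from K have "AE \<omega> in M. norm (h (X \<omega>)) \<le> B"
    by eventually_elim (auto intro: B)
  then show ?thesis by (rule ae_boundedI)
qed

lemma ae_bounded_norm_le:
  assumes "ae_bounded M Y" "AE \<omega> in M. norm (X \<omega>) \<le> norm (Y \<omega>)"
  shows "ae_bounded M X"
proof -
  obtain K where "AE \<omega> in M. norm (Y \<omega>) \<le> K"
    using assms(1) by (auto simp: ae_bounded_def)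
  with assms(2) have "AE \<omega> in M. norm (X \<omega>) \<le> K"
    by eventually_elim simp
  then show ?thesis by (rule ae_boundedI)
qed

lemma ae_bounded_power2_le:
  fixes Y :: "'w \<Rightarrow> real"
  assumes "0 < a" "ae_bounded M Y" "AE \<omega> in M. a * (norm (X \<omega>))\<^sup>2 \<le> Y \<omega>"
  shows "ae_bounded M X"
proof -
  obtain K where "AE \<omega> in M. norm (Y \<omega>) \<le> K"
    using assms(2) by (auto simp: ae_bounded_def)
  with assms(3) have "AE \<omega> in M. norm (X \<omega>) \<le> sqrt (K / a)"
  proof eventually_elim
    case (elim \<omega>)
    with \<open>0 < a\<close> have "(norm (X \<omega>))\<^sup>2 \<le> K / a"
      by (simp add: field_simps)
    then show ?case
      by (rule real_le_rsqrt)
  qed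
  then show ?thesis by (rule ae_boundedI)
qed

lemma ae_bounded_inner:
  assumes "ae_bounded M X" "ae_bounded M Y"
  shows "ae_bounded M (\<lambda>\<omega>. X \<omega> \<bullet> Y \<omega>)"
proof -
  obtain K L where "AE \<omega> in M. norm (X \<omega>) \<le> K" "AE \<omega> in M. norm (Y \<omega>) \<le> L"
    using assms by (auto simp: ae_bounded_def)
  then have "AE \<omega> in M. norm (X \<omega> \<bullet> Y \<omega>) \<le> K * L"
  proof eventually_elim
    case (elim \<omega>)
    have "norm (X \<omega> \<bullet> Y \<omega>) \<le> norm (X \<omega>) * norm (Y \<omega>)"
      by (simp add: Cauchy_Schwarz_ineq2)
    also have "\<dots> \<le> K * L"
      using elim by (intro mult_mono) (auto intro: order_trans[OF norm_ge_zero])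
    finally show ?case .
  qed
  then show ?thesis by (rule ae_boundedI)
qed

lemma ae_bounded_norm_power2:
  fixes X :: "'w \<Rightarrow> 'a::real_inner"
  assumes "ae_bounded M X"
  shows "ae_bounded M (\<lambda>\<omega>. (norm (X \<omega>))\<^sup>2)"
  using ae_bounded_inner[OF assms assms] by (simp add: power2_norm_eq_inner)

lemma (in finite_measure) ae_bounded_imp_integrable:
  fixes X :: "'a \<Rightarrow> 'b::{banach, second_countable_topology}"
  assumes "ae_bounded M X" "X \<in> borel_measurable M"
  shows "integrable M X"
  using assms integrable_const_bound by (auto simp: ae_bounded_def)

text \<open>Each coordinate of \<open>Y\<close> is \<open>F\<close>-measurable and can be pulled out
  of the conditional expectation; the finitely many exceptional null sets are then merged.
  Integrability is asked of each product because the pull-out is done coordinate by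
  coordinate.\<close>

lemma (in sigma_finite_subalgebra) real_cond_exp_inner:
  fixes X Y :: "'a \<Rightarrow> real ^ 'd"
  assumes Y: "Y \<in> borel_measurable F" and X: "X \<in> borel_measurable M"
    and int: "\<And>i. integrable M (\<lambda>\<omega>. Y \<omega> $ i * X \<omega> $ i)"
  shows "AE \<omega> in M. real_cond_exp M F (\<lambda>\<omega>. Y \<omega> \<bullet> X \<omega>) \<omega> = Y \<omega> \<bullet> vec_cond_exp M F X \<omega>"
proof -
  have "AE \<omega> in M. real_cond_exp M F (\<lambda>\<omega>. Y \<omega> $ i * X \<omega> $ i) \<omega>
      = Y \<omega> $ i * real_cond_exp M F (\<lambda>\<omega>. X \<omega> $ i) \<omega>" for i
    using int Y X by (intro real_cond_exp_mult) (auto intro: borel_measurable_continuous_on[OF continuous_on_component[OF continuous_on_id]])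
  then have "AE \<omega> in M. \<forall>i. real_cond_exp M F (\<lambda>\<omega>. Y \<omega> $ i * X \<omega> $ i) \<omega>
      = Y \<omega> $ i * real_cond_exp M F (\<lambda>\<omega>. X \<omega> $ i) \<omega>"
    by (simp add: AE_all_countable)
  moreover have "AE \<omega> in M. real_cond_exp M F (\<lambda>\<omega>. \<Sum>i\<in>UNIV. Y \<omega> $ i * X \<omega> $ i) \<omega>
      = (\<Sum>i\<in>UNIV. real_cond_exp M F (\<lambda>\<omega>. Y \<omega> $ i * X \<omega> $ i) \<omega>)"
    using int by (rule real_cond_exp_sum)
  ultimately show ?thesis
    by eventually_elim (simp add: inner_vec_def vec_cond_exp_def)
qed

subsection \<open>The convergence theorem\<close>

theorem theorem4:
  fixes f :: "real ^ 'd \<Rightarrow> real"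
    and gradf :: "real ^ 'd \<Rightarrow> real ^ 'd"
    and \<alpha> s :: real
    and xstar x0 v0 :: "real ^ 'd"
    and M :: "'w measure"
    and F :: "nat \<Rightarrow> 'w measure"
    and x v x' v' g \<delta> :: "nat \<Rightarrow> 'w \<Rightarrow> real ^ 'd"
  assumes alpha_pos: "\<alpha> > 0"
    and s_pos: "s > 0"
    and strongly_convex: "strongly_convex \<alpha> f"
    and gradient: "\<And>y. GDERIV f y :> gradf y"
    and minimizer: "\<And>y. f xstar \<le> f y"
    and prob_space: "prob_space M"
    and filtration: "filtration (space M) F"
    and subalgebra: "\<And>n. subalgebra M (F n)"
    and F_0: "sets (F 0) = {{}, space M}"
    and x_0: "\<And>\<omega>. \<omega> \<in> space M \<Longrightarrow> x 0 \<omega> = x0"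
    and v_0: "\<And>\<omega>. \<omega> \<in> space M \<Longrightarrow> v 0 \<omega> = v0"
    and x'_eq: "\<And>n \<omega>. \<omega> \<in> space M \<Longrightarrow> x' n \<omega> = x n \<omega> + s *\<^sub>R v n \<omega>"
    and v'_eq: "\<And>n \<omega>. \<omega> \<in> space M \<Longrightarrow>
        v' n \<omega> = v n \<omega>
          - inverse (1 + s * sqrt \<alpha>) *\<^sub>R ((s * sqrt \<alpha>) *\<^sub>R v n \<omega> + s *\<^sub>R g n \<omega>)
          - (s * sqrt \<alpha>) *\<^sub>R v' n \<omega>"
    and x_Suc: "\<And>n \<omega>. \<omega> \<in> space M \<Longrightarrow> x (Suc n) \<omega> = x' n \<omega> - \<delta> n \<omega>"
    and v_Suc: "\<And>n \<omega>. \<omega> \<in> space M \<Longrightarrow>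
        v (Suc n) \<omega> = v' n \<omega> + (inverse (1 + s * sqrt \<alpha>) * sqrt \<alpha>) *\<^sub>R \<delta> n \<omega>"
    and g_measurable: "\<And>n. g n \<in> borel_measurable (F (Suc n))"
    and \<delta>_measurable: "\<And>n. \<delta> n \<in> borel_measurable (F (Suc n))"
    and g_integrable: "\<And>n. integrable M (g n)"
    and g_unbiased: "\<And>n. AE \<omega> in M. vec_cond_exp M (F n) (g n) \<omega> = gradf (x' n \<omega>)"
    and decrease: "\<And>n. AE \<omega> in M.
        f (x (Suc n) \<omega>) \<le> f (x' n \<omega>) - s\<^sup>2 / 2 * (norm (g n \<omega>))\<^sup>2"
  shows "(\<forall>n.
        integrable M (\<lambda>\<omega>. lyapunov f \<alpha> s xstar (x (Suc n) \<omega>) (v (Suc n) \<omega>)) \<and>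
        (AE \<omega> in M.
           real_cond_exp M (F n)
             (\<lambda>\<omega>'. lyapunov f \<alpha> s xstar (x (Suc n) \<omega>') (v (Suc n) \<omega>')) \<omega>
           \<le> inverse (1 + s * sqrt \<alpha>) * lyapunov f \<alpha> s xstar (x n \<omega>) (v n \<omega>)))
    \<and> (v0 = 0 \<longrightarrow>
        (\<forall>n.
          integrable M (\<lambda>\<omega>. f (x n \<omega>) - f xstar) \<and>
          prob_space.expectation M (\<lambda>\<omega>. f (x n \<omega>) - f xstar)
            \<le> 2 * inverse (1 + s * sqrt \<alpha>) ^ n * (f x0 - f xstar)))"
proof -

  \<comment> \<open>Sigma-algebras of the filtration and constants\<close>
  interpret prob_space M by (rule prob_space)
  have sub: "sigma_finite_subalgebra M (F n)" for n
    using subalgebra[of n] finite_measure_axioms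
    by (intro finite_measure_subalgebra_is_sigma_finite finite_measure_subalgebra.intro)
       (auto simp: finite_measure_subalgebra_axioms_def)
  have space_F: "space (F n) = space M" for n
    using subalgebra[of n] by (simp add: subalgebra_def)
  have F_mono: "X \<in> borel_measurable (F n) \<Longrightarrow> X \<in> borel_measurable (F (Suc n))"
    for X :: "'w \<Rightarrow> real ^ 'd" and n
    using filtration.sets_F_mono[OF filtration, of n "Suc n"] space_F
    by (auto simp: measurable_def)
  have F_M: "X \<in> borel_measurable (F n) \<Longrightarrow> X \<in> borel_measurable M"
    for X :: "'w \<Rightarrow> 'z::topological_space" and n
    by (rule measurable_from_subalg[OF subalgebra])

  define q where "q = sqrt \<alpha>"
  define c where "c = 1 + s * q"
  define r where "r = inverse c"
  have q: "0 < q" "q\<^sup>2 = \<alpha>"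
    using alpha_pos by (simp_all add: q_def)
  have c: "1 < c"
    using q s_pos by (simp add: c_def)
  have r: "0 < r" "r \<le> 1" "r * c = 1"
    using c by (simp_all add: r_def inverse_le_1_iff)
  have cont: "continuous_on UNIV f"
    using gradient unfolding gderiv_def
    by (meson continuous_at_imp_continuous_on has_derivative_continuous)
  have f_meas [measurable]: "f \<in> borel_measurable borel"
    by (rule borel_measurable_continuous_onI[OF cont])

  \<comment> \<open>Explicit recursion and adaptedness\<close>
  have v_Suc': "v (Suc n) \<omega> = r\<^sup>2 *\<^sub>R (v n \<omega> - s *\<^sub>R g n \<omega>) + (r * q) *\<^sub>R \<delta> n \<omega>"
    if "\<omega> \<in> space M" for n \<omega>
  proof -
    have "v' n \<omega> = r\<^sup>2 *\<^sub>R (v n \<omega> - s *\<^sub>R g n \<omega>)"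
      unfolding r_def c_def q_def
      by (rule momentum_step_explicit[OF _ v'_eq[OF that]]) (use c in \<open>simp add: c_def q_def\<close>)
    with v_Suc[OF that, of n] show ?thesis
      by (simp only: r_def c_def q_def)
  qed
  have x_Suc': "x (Suc n) \<omega> = x n \<omega> + s *\<^sub>R v n \<omega> - \<delta> n \<omega>" if "\<omega> \<in> space M" for n \<omega>
    using that by (simp add: x_Suc x'_eq)

  have meas: "x n \<in> borel_measurable (F n) \<and> v n \<in> borel_measurable (F n)" for n
  proof (induction n)
    case 0
    \<comment> \<open>Initial values and updates are prescribed only on \<open>space M\<close>, so
      measurability is transported from the formulas by \<open>measurable_cong\<close>.\<close>
    have "x 0 \<in> borel_measurable (F 0) \<longleftrightarrow> (\<lambda>_. x0) \<in> borel_measurable (F 0)"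
      "v 0 \<in> borel_measurable (F 0) \<longleftrightarrow> (\<lambda>_. v0) \<in> borel_measurable (F 0)"
      by (rule measurable_cong, simp add: space_F x_0 v_0)+
    then show ?case by simp
  next
    case (Suc n)
    note [measurable] = Suc.IH[THEN conjunct1, THEN F_mono] Suc.IH[THEN conjunct2, THEN F_mono]
      g_measurable[of n] \<delta>_measurable[of n]
    \<comment> \<open>The explicit form of the velocity bypasses the implicitly given
      \<open>v' n\<close>.\<close>
    have "x (Suc n) \<in> borel_measurable (F (Suc n)) \<longleftrightarrow>
        (\<lambda>\<omega>. x n \<omega> + s *\<^sub>R v n \<omega> - \<delta> n \<omega>) \<in> borel_measurable (F (Suc n))"
      "v (Suc n) \<in> borel_measurable (F (Suc n)) \<longleftrightarrow>
        (\<lambda>\<omega>. r\<^sup>2 *\<^sub>R (v n \<omega> - s *\<^sub>R g n \<omega>) + (r * q) *\<^sub>R \<delta> n \<omega>) \<in> borel_measurable (F (Suc n))"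
      by (rule measurable_cong, simp add: space_F x_Suc' v_Suc')+
    then show ?case by simp
  qed
  note [measurable] = meas[THEN conjunct1] meas[THEN conjunct2]
  have x'_meas [measurable]: "x' n \<in> borel_measurable (F n)" for n
  proof -
    have "x' n \<in> borel_measurable (F n) \<longleftrightarrow> (\<lambda>\<omega>. x n \<omega> + s *\<^sub>R v n \<omega>) \<in> borel_measurable (F n)"
      by (rule measurable_cong) (simp add: space_F x'_eq)
    then show ?thesis by simp
  qed

  \<comment> \<open>Almost sure boundedness of the iterates\<close>
  have x'_bdd: "ae_bounded M (x' n)" if "ae_bounded M (x n)" "ae_bounded M (v n)" for n
  proof (rule ae_bounded_norm_le)
    show "ae_bounded M (\<lambda>\<omega>. x n \<omega> + s *\<^sub>R v n \<omega>)"
      using that by (intro ae_bounded_add ae_bounded_scaleR)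
  qed (simp add: x'_eq)
  \<comment> \<open>Since \<open>f (x (Suc n) \<omega>)\<close> is at least \<open>f xstar\<close>,
    the decrease term in \<open>g n\<close> cannot exceed the gap at \<open>x' n\<close>.\<close>
  have g_bdd: "ae_bounded M (g n)" if "ae_bounded M (x' n)" for n
  proof (rule ae_bounded_power2_le)
    show "ae_bounded M (\<lambda>\<omega>. f (x' n \<omega>) - f xstar)"
      using that by (intro ae_bounded_diff ae_bounded_const ae_bounded_continuous_image[OF cont])
    show "AE \<omega> in M. s\<^sup>2 / 2 * (norm (g n \<omega>))\<^sup>2 \<le> f (x' n \<omega>) - f xstar"
      using decrease[of n]
    proof eventually_elim
      case (elim \<omega>)
      with minimizer[of "x (Suc n) \<omega>"] show ?case by linarith
    qed
  qed (use s_pos in simp)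
  have bdd: "ae_bounded M (x n) \<and> ae_bounded M (v n)" for n
  proof (induction n)
    case 0
    have "ae_bounded M (x 0)" "ae_bounded M (v 0)"
      by (rule ae_bounded_norm_le[OF ae_bounded_const[of M x0]], simp add: x_0)
         (rule ae_bounded_norm_le[OF ae_bounded_const[of M v0]], simp add: v_0)
    then show ?case ..
  next
    case (Suc n)
    then have x': "ae_bounded M (x' n)" and v: "ae_bounded M (v n)"
      using x'_bdd by auto
    \<comment> \<open>The step does not increase \<open>f\<close> beyond its value at
      \<open>x' n\<close>, and quadratic growth around \<open>xstar\<close> turns this into a
      distance bound.\<close>
    have "ae_bounded M (\<lambda>\<omega>. x (Suc n) \<omega> - xstar)"
    proof (rule ae_bounded_power2_le)
      show "ae_bounded M (\<lambda>\<omega>. f (x' n \<omega>) - f xstar)"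
        using x' by (intro ae_bounded_diff ae_bounded_const ae_bounded_continuous_image[OF cont])
      show "AE \<omega> in M. \<alpha> / 2 * (norm (x (Suc n) \<omega> - xstar))\<^sup>2 \<le> f (x' n \<omega>) - f xstar"
        using decrease[of n]
      proof eventually_elim
        case (elim \<omega>)
        moreover have "0 \<le> s\<^sup>2 / 2 * (norm (g n \<omega>))\<^sup>2"
          by simp
        ultimately show ?case
          using strongly_convex_minimizer_growth[OF strongly_convex minimizer, of "x (Suc n) \<omega>"]
          by linarith
      qed
    qed (use alpha_pos in simp)
    from ae_bounded_add[OF this ae_bounded_const[of M xstar]]
    have x: "ae_bounded M (x (Suc n))"
      by simp
    \<comment> \<open>The bound on \<open>\<delta> n\<close> is recovered from those on the two
      positions it connects.\<close>
    have "ae_bounded M (\<delta> n)"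
    proof (rule ae_bounded_norm_le)
      show "ae_bounded M (\<lambda>\<omega>. x' n \<omega> - x (Suc n) \<omega>)"
        using x x' by (intro ae_bounded_diff)
    qed (simp add: x_Suc)
    then have bd: "ae_bounded M (\<lambda>\<omega>. r\<^sup>2 *\<^sub>R (v n \<omega> - s *\<^sub>R g n \<omega>) + (r * q) *\<^sub>R \<delta> n \<omega>)"
      using v g_bdd[OF x'] by (intro ae_bounded_add ae_bounded_scaleR ae_bounded_diff)
    have "ae_bounded M (v (Suc n))"
      using bd by (rule ae_bounded_norm_le) (simp add: v_Suc')
    with x show ?case ..
  qed
  then have x_bdd: "ae_bounded M (x n)" and v_bdd: "ae_bounded M (v n)" for n
    by auto
  note x'_bdd = x'_bdd[OF x_bdd v_bdd]
  note g_bdd = g_bdd[OF x'_bdd]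

  \<comment> \<open>Integrability of the gap and of the Lyapunov sequence\<close>
  have x_M [measurable]: "x n \<in> borel_measurable M" and v_M [measurable]: "v n \<in> borel_measurable M"
    and g_M [measurable]: "g n \<in> borel_measurable M" for n
    using F_M meas g_measurable by blast+
  define L where "L n \<omega> = lyapunov f \<alpha> s xstar (x n \<omega>) (v n \<omega>)" for n \<omega>
  have L_eq: "L n \<omega> = f (x n \<omega>) - f xstar + 1 / 2 * (norm (q *\<^sub>R (x n \<omega> - xstar) + c *\<^sub>R v n \<omega>))\<^sup>2"
    for n \<omega>
    by (simp add: L_def lyapunov_def q_def c_def)
  have bdd_cmult: "ae_bounded M (\<lambda>\<omega>. a * X \<omega>)" if "ae_bounded M X" for a and X :: "'w \<Rightarrow> real"
    using ae_bounded_scaleR[OF that, of a] by simp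
  have int_f: "integrable M (\<lambda>\<omega>. f (x n \<omega>) - f xstar)" for n
    by (intro ae_bounded_imp_integrable ae_bounded_diff ae_bounded_const
        ae_bounded_continuous_image[OF cont] x_bdd) simp
  have int_L: "integrable M (L n)" for n
    unfolding L_eq
    by (intro ae_bounded_imp_integrable ae_bounded_diff ae_bounded_add ae_bounded_const bdd_cmult
        ae_bounded_norm_power2 ae_bounded_scaleR
        ae_bounded_continuous_image[OF cont] x_bdd v_bdd) simp

  \<comment> \<open>Contraction of one step in conditional expectation\<close>
  have step: "AE \<omega> in M. real_cond_exp M (F n) (L (Suc n)) \<omega> \<le> r * L n \<omega>" for n
  proof -
    interpret sub: sigma_finite_subalgebra M "F n" by (rule sub)
    \<comment> \<open>\<open>U\<close> is the constant part and \<open>Y\<close> the coefficient of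
      the upper bound affine in \<open>g n\<close>. Both are \<open>F n\<close>-measurable, so
      conditioning merely replaces \<open>g n\<close> by its conditional mean.\<close>
    define U where "U \<omega> = f (x' n \<omega>) - f xstar + 1 / 2 * (norm (q *\<^sub>R (x' n \<omega> - xstar) + r *\<^sub>R v n \<omega>))\<^sup>2
        + (1 - r) * r / 2 * (norm (v n \<omega>))\<^sup>2" for \<omega>
    define Y where "Y \<omega> = (- (r * s)) *\<^sub>R (q *\<^sub>R (x' n \<omega> - xstar) + v n \<omega>)" for \<omega>
    have U_meas [measurable]: "U \<in> borel_measurable (F n)"
      unfolding U_def by measurable
    have Y_meas [measurable]: "Y \<in> borel_measurable (F n)"
      unfolding Y_def by measurable
    have Y_M [measurable]: "Y \<in> borel_measurable M"
      by (rule F_M[OF Y_meas])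
    have "ae_bounded M U"
      unfolding U_def
      by (intro ae_bounded_diff ae_bounded_add ae_bounded_const bdd_cmult
        ae_bounded_norm_power2 ae_bounded_scaleR
        ae_bounded_continuous_image[OF cont] x'_bdd v_bdd)
    then have int_U: "integrable M U"
      by (rule ae_bounded_imp_integrable[OF _ F_M[OF U_meas]])
    have Y_bdd: "ae_bounded M Y"
      unfolding Y_def
      by (intro ae_bounded_scaleR ae_bounded_diff ae_bounded_add ae_bounded_const x'_bdd v_bdd)
    have int_Yg: "integrable M (\<lambda>\<omega>. Y \<omega> \<bullet> g n \<omega>)"
      by (intro ae_bounded_imp_integrable ae_bounded_inner Y_bdd g_bdd) measurable
    have int_Yg_i: "integrable M (\<lambda>\<omega>. Y \<omega> $ i * g n \<omega> $ i)" for i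
    proof -
      have comp: "continuous_on UNIV (\<lambda>a :: real ^ 'd. a $ i)"
        by (rule continuous_on_component[OF continuous_on_id])
      have "ae_bounded M (\<lambda>\<omega>. Y \<omega> $ i * g n \<omega> $ i)"
        using ae_bounded_inner[OF ae_bounded_continuous_image[OF comp Y_bdd]
            ae_bounded_continuous_image[OF comp g_bdd]] by simp
      moreover have "(\<lambda>\<omega>. Y \<omega> $ i * g n \<omega> $ i) \<in> borel_measurable M"
        by (intro borel_measurable_times borel_measurable_continuous_on[OF comp] Y_M g_M)
      ultimately show ?thesis
        by (rule ae_bounded_imp_integrable)
    qed
    have "AE \<omega> in M. L (Suc n) \<omega> \<le> U \<omega> + Y \<omega> \<bullet> g n \<omega>"
      using decrease[of n] AE_space
    proof eventually_elim
      case (elim \<omega>)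
      have "q *\<^sub>R (x (Suc n) \<omega> - xstar) + c *\<^sub>R v (Suc n) \<omega>
          = q *\<^sub>R (x' n \<omega> - xstar) + r *\<^sub>R (v n \<omega> - s *\<^sub>R g n \<omega>)"
        using shifted_momentum_step[OF r(3)] elim(2) by (simp add: x_Suc v_Suc')
      then show ?case
        using elim(1) quadratic_step_bound[of r q "x' n \<omega> - xstar" "v n \<omega>" s "g n \<omega>"] r
        by (simp add: L_eq U_def Y_def inner_commute[of _ "g n \<omega>"])
    qed
    then have "AE \<omega> in M. real_cond_exp M (F n) (L (Suc n)) \<omega>
        \<le> real_cond_exp M (F n) (\<lambda>\<omega>. U \<omega> + Y \<omega> \<bullet> g n \<omega>) \<omega>"
      using int_L int_U int_Yg by (intro sub.real_cond_exp_mono) auto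
    moreover have "AE \<omega> in M. real_cond_exp M (F n) (\<lambda>\<omega>. U \<omega> + Y \<omega> \<bullet> g n \<omega>) \<omega>
        = real_cond_exp M (F n) U \<omega> + real_cond_exp M (F n) (\<lambda>\<omega>. Y \<omega> \<bullet> g n \<omega>) \<omega>"
      by (rule sub.real_cond_exp_add[OF int_U int_Yg])
    moreover have "AE \<omega> in M. real_cond_exp M (F n) U \<omega> = U \<omega>"
      by (rule sub.real_cond_exp_F_meas[OF int_U U_meas])
    moreover have "AE \<omega> in M. real_cond_exp M (F n) (\<lambda>\<omega>. Y \<omega> \<bullet> g n \<omega>) \<omega>
        = Y \<omega> \<bullet> vec_cond_exp M (F n) (g n) \<omega>"
      by (rule sub.real_cond_exp_inner[OF Y_meas g_M int_Yg_i])
    ultimately show ?thesis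
      using g_unbiased[of n] AE_space
    proof eventually_elim
      case (elim \<omega>)
      let ?d = "gradf (x' n \<omega>)"
      have x: "x n \<omega> - x' n \<omega> = - (s *\<^sub>R v n \<omega>)"
        using elim(6) by (simp add: x'_eq)
      \<comment> \<open>Passing from \<open>x n\<close> to \<open>x' n\<close> absorbs the part
        \<open>s * q\<close> of the coefficient \<open>c\<close> of \<open>v n\<close>.\<close>
      have *: "q *\<^sub>R (x n \<omega> - xstar) + c *\<^sub>R v n \<omega> = q *\<^sub>R (x' n \<omega> - xstar) + v n \<omega>"
        using elim(6) by (simp add: x'_eq c_def algebra_simps)
      \<comment> \<open>Strong convexity at \<open>x' n\<close> is tested at \<open>x n\<close>,
        where the displacement is \<open>- s *\<^sub>R v n \<omega>\<close>, and next at
        \<open>xstar\<close>.\<close>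
      have "f (x' n \<omega>) \<le> f (x n \<omega>) + s * (?d \<bullet> v n \<omega>) - q\<^sup>2 / 2 * (s\<^sup>2 * (norm (v n \<omega>))\<^sup>2)"
        using strongly_convex_gradient[OF strongly_convex gradient, of "x' n \<omega>" "x n \<omega>"]
        unfolding x by (simp add: q power_mult_distrib)
      moreover have "f (x' n \<omega>) - f xstar
          \<le> ?d \<bullet> (x' n \<omega> - xstar) - q\<^sup>2 / 2 * (norm (x' n \<omega> - xstar))\<^sup>2"
        using strongly_convex_gradient[OF strongly_convex gradient, of "x' n \<omega>" xstar]
        by (simp add: q norm_minus_commute inner_diff_right)
      ultimately have "U \<omega> + Y \<omega> \<bullet> ?d \<le> r * L n \<omega>"
        using quadratic_contraction[OF c_def r(3)] s_pos q(1)
        by (simp add: U_def Y_def L_eq * inner_commute[of _ ?d])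
      with elim show ?case
        by simp
    qed
  qed

  \<comment> \<open>Iteration in expectation and the rate\<close>
  have expectation_L: "expectation (L n) \<le> r ^ n * expectation (L 0)" for n
  proof (induction n)
    case (Suc n)
    interpret sub: sigma_finite_subalgebra M "F n" by (rule sub)
    \<comment> \<open>Integrating the conditional expectation returns the expectation, so the almost
      sure contraction can be iterated.\<close>
    have "expectation (L (Suc n)) = expectation (real_cond_exp M (F n) (L (Suc n)))"
      by (rule sub.real_cond_exp_int(2)[OF int_L, symmetric])
    also have "\<dots> \<le> expectation (\<lambda>\<omega>. r * L n \<omega>)"
      by (intro integral_mono_AE sub.real_cond_exp_int(1) int_L integrable_mult_right step)
    also have "\<dots> = r * expectation (L n)"
      by simp
    also have "\<dots> \<le> r * (r ^ n * expectation (L 0))"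
      using Suc r(1) by (intro mult_left_mono) auto
    finally show ?case by simp
  qed simp

  have rate: "expectation (\<lambda>\<omega>. f (x n \<omega>) - f xstar) \<le> 2 * r ^ n * (f x0 - f xstar)"
    if "v0 = 0" for n
  proof -
    \<comment> \<open>The gap is \<open>L n\<close> without its nonnegative square.\<close>
    have "expectation (\<lambda>\<omega>. f (x n \<omega>) - f xstar) \<le> expectation (L n)"
      by (intro integral_mono int_f int_L) (simp add: L_eq)
    also note expectation_L
    \<comment> \<open>With \<open>v0 = 0\<close> the square in \<open>L 0\<close> reduces to
      \<open>\<alpha> / 2\<close> times the squared distance to \<open>xstar\<close>, which
      quadratic growth bounds by one more copy of the initial gap; this is the factor 2.\<close>
    also have "expectation (L 0) = expectation (\<lambda>\<omega>. f x0 - f xstar + \<alpha> / 2 * (norm (x0 - xstar))\<^sup>2)"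
      by (rule Bochner_Integration.integral_cong)
         (simp_all add: L_eq x_0 v_0 that power_mult_distrib q)
    also have "\<dots> \<le> 2 * (f x0 - f xstar)"
      using strongly_convex_minimizer_growth[OF strongly_convex minimizer, of x0]
      by (simp add: prob_space)
    finally show ?thesis
      using r(1) by (simp add: mult_left_mono algebra_simps)
  qed

  show ?thesis
    using int_L step int_f rate unfolding L_def r_def c_def q_def by blast
qed

end
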